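(* Let $c\in\mathbb{N}$ be fixed, let $\tilde Y^{(c)}\sim\mathrm{Gamma}(c,1)$ with CDF $F$, and let $\tilde Y_{n:n}^{(c)}$ be the maximum of $n$ i.i.d. copies of $\tilde Y^{(c)}$. For every integer $r\ge1$ there is a sequence $(t_n)$, with $t_n\ge\mathbb{E}[(\tilde Y^{(c)})^r]$ for all sufficiently large $n$, such that the lower bound $$L_n=t_n-\bigl(t_n-\mathbb{E}[(\tilde Y^{(c)})^r]\bigr)\,F\bigl(t_n^{1/r}\bigr)^{n-1}\ \le\ \mathbb{E}\bigl[(\tilde Y_{n:n}^{(c)})^r\bigr]$$ (valid whenever $t_n\ge\mathbb{E}[(\tilde Y^{(c)})^r]$) is asymptotically tight in $n$: $$\lim_{n\to\infty}\frac{L_n}{\mathbb{E}[(\tilde Y_{n:n}^{(c)})^r]}=1.$$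
   Context: $\mathrm{Gamma}(c,1)$ is the law of the sum of $c$ independent unit-rate exponential random variables. The lower bound is the de la Cal–Cárcamo inequality: for i.i.d. $Z_1,\ldots,Z_n$ with mean $\mu_Z$ and CDF $F_Z$, $\mathbb{E}[\max_jZ_j]\ge t-(t-\mu_Z)F_Z(t)^{n-1}$ for all $t\ge\mu_Z$, applied to $Z_j=(\tilde Y_j^{(c)})^r$. *)

theory Defs
  imports "HOL-Probability.Probability"
begin

definition gamma_law :: "nat \<Rightarrow> real measure" where
  "gamma_law c =
     distr (PiM {..<c} (\<lambda>_. density lborel (\<lambda>x. ennreal (exponential_density 1 x))))
       borel (\<lambda>x. \<Sum>i<c. x i)"

definition gamma_moment :: "nat \<Rightarrow> nat \<Rightarrow> real" where
  "gamma_moment c r = (\<integral>y. y ^ r \<partial>gamma_law c)"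

(* The de la Cal--Carcamo lower bound at level t for n copies of the r-th power of a
   Gamma(c,1) variable, whose distribution function at t >= 0 is F (t^(1/r)). *)
definition gamma_lower_bound :: "nat \<Rightarrow> nat \<Rightarrow> nat \<Rightarrow> real \<Rightarrow> real" where
  "gamma_lower_bound c r n t =
     t - (t - gamma_moment c r) * cdf (gamma_law c) (root r t) ^ (n - 1)"

end

theory Submission
  imports Defs "HOL-Real_Asymp.Real_Asymp"
begin

text \<open>
  The lower bound holds because the maximum is at least \<open>t\<close> unless the first \<open>n - 1\<close> copies of
  \<open>Z = Y ^ r\<close> are all at most \<open>t\<close>, in which case it is still at least the last copy, which is
  independent of that event. The Gamma tail dominates \<open>exp (- x)\<close>, so with
  \<open>t = (ln n - ln (ln n)) ^ r\<close> we get \<open>F (root r t) ^ (n - 1) \<le> exp (- (n - 1) * ln n / n)\<close>, which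
  tends to 0, and the lower bound is asymptotic to \<open>(ln n) ^ r\<close>. Conversely, for every \<open>s < 1\<close> the
  mean of \<open>Y ^ r * exp (s * Y)\<close> is finite; truncating the maximum at \<open>ln n / s\<close> and using a union
  bound shows that its \<open>r\<close>-th moment is at most \<open>(ln n / s) ^ r\<close> plus a constant.
\<close>

section \<open>The Gamma law: support, exponential moments and tail\<close>

lemma prob_space_gamma_law: "prob_space (gamma_law c)"
  unfolding gamma_law_def
  by (intro prob_space.prob_space_distr prob_space_PiM prob_space_exponential_density) auto

lemma sets_gamma_law [simp, measurable_cong]: "sets (gamma_law c) = sets borel"
  by (simp add: gamma_law_def)

lemma space_gamma_law [simp]: "space (gamma_law c) = UNIV"
  by (simp add: gamma_law_def)

lemma AE_exponential_nonneg:
  "AE x in density lborel (\<lambda>x. ennreal (exponential_density l x)). 0 \<le> x"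
  by (subst AE_density) (auto simp: exponential_density_def intro!: AE_I2)

lemma AE_gamma_law_components_nonneg:
  fixes c :: nat
  shows "AE x in PiM {..<c} (\<lambda>_. density lborel (\<lambda>x. ennreal (exponential_density 1 x))).
     \<forall>i\<in>{..<c}. (0::real) \<le> x i"
  by (intro AE_finite_allI AE_PiM_component prob_space_exponential_density AE_exponential_nonneg)
     auto

lemma AE_gamma_law_nonneg: "AE y in gamma_law c. 0 \<le> y"
  unfolding gamma_law_def
proof (subst AE_distr_iff)
  show "AE x in PiM {..<c} (\<lambda>_. density lborel (\<lambda>x. ennreal (exponential_density 1 x))).
     (0::real) \<le> (\<Sum>i<c. x i)"
    using AE_gamma_law_components_nonneg by eventually_elim (auto intro: sum_nonneg)
qed auto

text \<open>Tilting the unit-rate density by \<open>exp (s * x)\<close> gives, up to the factor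
  \<open>1 / (1 - s)\<close>, the exponential density of rate \<open>1 - s\<close>, which has total
  mass 1.\<close>

lemma integrable_exp_exponential:
  assumes "s < 1"
  shows "integrable (density lborel (\<lambda>x. ennreal (exponential_density 1 x))) (\<lambda>x::real. exp (s * x))"
proof -
  interpret prob_space "density lborel (\<lambda>x. ennreal (exponential_density (1 - s) x))"
    using assms by (intro prob_space_exponential_density) auto
  have "integrable (density lborel (\<lambda>x. ennreal (exponential_density (1 - s) x))) (\<lambda>x. 1::real)"
    by simp
  then have "integrable lborel (\<lambda>x. exponential_density (1 - s) x * 1)"
    using assms by (subst (asm) integrable_density) (auto simp: exponential_density_def)
  then have "integrable lborel (\<lambda>x. inverse (1 - s) * exponential_density (1 - s) x)"
    by (intro integrable_mult_right) auto
  also have "(\<lambda>x. inverse (1 - s) * exponential_density (1 - s) x) =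
      (\<lambda>x. exponential_density 1 x *\<^sub>R exp (s * x))"
    using assms
    by (auto simp: exponential_density_def fun_eq_iff field_simps simp flip: exp_add)
  finally show ?thesis
    by (subst integrable_density) (auto simp: exponential_density_def)
qed

text \<open>The exponential of a sum is a product over the coordinates, so integrability on the
  product space reduces to that of a single exponential factor.\<close>

lemma integrable_gamma_law_exp:
  assumes "s < 1"
  shows "integrable (gamma_law c) (\<lambda>y. exp (s * y))"
proof -
  interpret prob_space "density lborel (\<lambda>x. ennreal (exponential_density 1 x))"
    by (intro prob_space_exponential_density) auto
  interpret product_sigma_finite "\<lambda>_::nat. density lborel (\<lambda>x. ennreal (exponential_density 1 x))"
    by standard
  have "integrable (PiM {..<c} (\<lambda>_. density lborel (\<lambda>x. ennreal (exponential_density 1 x))))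
     (\<lambda>x. \<Prod>i<c. exp (s * x i))"
    by (intro product_integrable_prod integrable_exp_exponential assms) auto
  then show ?thesis
    unfolding gamma_law_def by (subst integrable_distr_eq) (auto simp: exp_sum sum_distrib_left)
qed

text \<open>For nonnegative \<open>x\<close> the term of index \<open>r\<close> is at most the whole
  exponential series.\<close>

lemma power_le_fact_exp:
  fixes x :: real
  assumes "0 \<le> x"
  shows "x ^ r \<le> fact r * exp x"
proof -
  have "x ^ r /\<^sub>R fact r \<le> exp x"
    unfolding exp_def using assms
    by (intro sums_le[OF _ sums_single[of r] summable_sums[OF summable_exp_generic], THEN order_trans[rotated]])
       auto
  then show ?thesis
    by (simp add: field_simps)
qed

text \<open>The gap between \<open>s\<close> and 1 leaves room to absorb \<open>y ^ r\<close> into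
  an exponential of slightly larger rate, still below 1. This supplies the constant in the upper
  bound for the maximum, and at \<open>s = 0\<close> all moments.\<close>

lemma integrable_gamma_law_power_exp:
  assumes "s < 1"
  shows "integrable (gamma_law c) (\<lambda>y. y ^ r * exp (s * y))"
proof (rule Bochner_Integration.integrable_bound)
  \<comment> \<open>Half of the gap pays for the polynomial factor and keeps \<open>s + e\<close>
    below 1.\<close>
  define e where "e = (1 - s) / 2"
  have e: "e > 0" "s + e < 1"
    using assms by (auto simp: e_def field_simps)
  show "integrable (gamma_law c) (\<lambda>y. fact r / e ^ r * exp ((s + e) * y))"
    by (intro integrable_mult_right integrable_gamma_law_exp e)
  show "AE y in gamma_law c. norm (y ^ r * exp (s * y)) \<le> norm (fact r / e ^ r * exp ((s + e) * y))"
    using AE_gamma_law_nonneg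
  proof eventually_elim
    case (elim y)
    have "(e * y) ^ r \<le> fact r * exp (e * y)"
      using e elim by (intro power_le_fact_exp) auto
    then have "y ^ r \<le> fact r / e ^ r * exp (e * y)"
      using e by (simp add: power_mult_distrib field_simps)
    then have "y ^ r * exp (s * y) \<le> fact r / e ^ r * exp (e * y) * exp (s * y)"
      by (intro mult_right_mono) auto
    then show ?case
      using e elim by (simp add: exp_add algebra_simps)
  qed
qed measurable

lemma integrable_gamma_law_power: "integrable (gamma_law c) (\<lambda>y. y ^ r)"
  using integrable_gamma_law_power_exp[of 0] by simp

lemma gamma_moment_nonneg: "0 \<le> gamma_moment c r"
  unfolding gamma_moment_def
  by (intro integral_nonneg_AE eventually_mono[OF AE_gamma_law_nonneg]) auto

text \<open>Almost surely the sum dominates its summand of index 0, whose tail is exactly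
  \<open>exp (- x)\<close>. For \<open>c = 0\<close> there is no such summand: the law is the point
  mass at 0 and the estimate fails.\<close>

lemma cdf_gamma_law_le:
  assumes "1 \<le> c" "0 \<le> x"
  shows "cdf (gamma_law c) x \<le> 1 - exp (- x)"
proof -
  define E where "E = density lborel (\<lambda>x::real. ennreal (exponential_density 1 x))"
  define P where "P = PiM {..<c} (\<lambda>_. E)"
  interpret E: prob_space E
    unfolding E_def by (intro prob_space_exponential_density) auto
  interpret P: prob_space P
    unfolding P_def by (intro prob_space_PiM E.prob_space_axioms)
  interpret G: prob_space "gamma_law c"
    by (rule prob_space_gamma_law)
  have [measurable_cong]: "sets E = sets borel"
    by (simp add: E_def)
  have G: "gamma_law c = distr P borel (\<lambda>x. \<Sum>i<c. x i)"
    by (simp add: gamma_law_def P_def E_def)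
  have "(\<lambda>\<omega>. \<omega> 0) \<in> measurable P E"
    unfolding P_def using assms by (intro measurable_component_singleton) auto
  then have meas0: "(\<lambda>\<omega>. \<omega> 0) \<in> borel_measurable P"
    by (simp cong: measurable_cong_sets add: E_def)
  have meas: "(\<lambda>\<omega>. \<Sum>i<c. \<omega> i) \<in> borel_measurable P"
    unfolding P_def by measurable
  have "distr P borel (\<lambda>\<omega>. \<omega> 0) = distr P E (\<lambda>\<omega>. \<omega> 0)"
    by (intro distr_cong) (auto simp: E_def)
  also have "\<dots> = E"
    unfolding P_def using assms by (intro distr_PiM_component E.prob_space_axioms) auto
  finally have "distributed P lborel (\<lambda>\<omega>. \<omega> 0) (exponential_density 1)"
    using meas0 unfolding distributed_def E_def
    by (auto cong: distr_cong)
  from P.exponential_distributedD_gt[OF this, of x] assms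
  have "exp (- x) = measure P {\<omega>\<in>space P. x < \<omega> 0}"
    by simp
  also have "\<dots> \<le> measure P {\<omega>\<in>space P. x < (\<Sum>i<c. \<omega> i)}"
  proof (intro P.finite_measure_mono_AE)
    have "AE \<omega> in P. \<forall>i\<in>{..<c}. 0 \<le> \<omega> i"
      unfolding P_def E_def by (rule AE_gamma_law_components_nonneg)
    then show "AE \<omega> in P. \<omega> \<in> {\<omega>\<in>space P. x < \<omega> 0} \<longrightarrow> \<omega> \<in> {\<omega>\<in>space P. x < (\<Sum>i<c. \<omega> i)}"
    proof eventually_elim
      case (elim \<omega>)
      have "\<omega> 0 \<le> (\<Sum>i<c. \<omega> i)"
        using assms elim by (intro member_le_sum) auto
      then show ?case by auto
    qed
  qed (use meas in measurable)
  also have "\<dots> = measure (gamma_law c) {x<..}"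
    unfolding G using meas by (subst measure_distr) (auto intro!: arg_cong[where f = "measure P"])
  also have "{x<..} = space (gamma_law c) - {..x}"
    by auto
  also have "measure (gamma_law c) \<dots> = 1 - cdf (gamma_law c) x"
    unfolding cdf_def by (intro G.prob_compl) auto
  finally show ?thesis by simp
qed

section \<open>Bounds on the moments of a maximum of identically distributed nonnegative
  variables\<close>

lemma integral_distr_eq:
  fixes f :: "_ \<Rightarrow> real"
  assumes "X \<in> measurable M N" "distr M N X = D" "f \<in> borel_measurable N"
  shows "(\<integral>\<omega>. f (X \<omega>) \<partial>M) = (\<integral>y. f y \<partial>D)"
  using integral_distr[OF assms(1,3)] assms(2) by simp

lemma integrable_distrD:
  fixes f :: "_ \<Rightarrow> real"
  assumes "X \<in> measurable M N" "distr M N X = D" "f \<in> borel_measurable N" "integrable D f"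
  shows "integrable M (\<lambda>\<omega>. f (X \<omega>))"
  using integrable_distr_eq[OF assms(1,3)] assms(2,4) by simp

context prob_space
begin

lemma AE_all_nonneg_of_distr:
  fixes Y :: "nat \<Rightarrow> 'a \<Rightarrow> real"
  assumes "\<And>i. random_variable borel (Y i)" "\<And>i. distr M borel (Y i) = D" "AE y in D. 0 \<le> y"
  shows "AE \<omega> in M. \<forall>i. 0 \<le> Y i \<omega>"
proof -
  have "AE \<omega> in M. 0 \<le> Y i \<omega>" for i
    using assms(3) unfolding assms(2)[of i, symmetric] by (rule AE_distrD[OF assms(1)])
  then show ?thesis by (simp add: AE_all_countable)
qed

text \<open>The maximum is attained at some index, so its power is one of the nonnegative terms of
  an integrable sum.\<close>

lemma integrable_Max_power:
  fixes Y :: "nat \<Rightarrow> 'a \<Rightarrow> real"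
  assumes [measurable]: "\<And>i. random_variable borel (Y i)"
    and "\<And>i. integrable M (\<lambda>\<omega>. Y i \<omega> ^ r)" "AE \<omega> in M. \<forall>i. 0 \<le> Y i \<omega>" "1 \<le> n"
  shows "integrable M (\<lambda>\<omega>. (MAX i\<in>{..<n}. Y i \<omega>) ^ r)"
proof (rule Bochner_Integration.integrable_bound)
  show "integrable M (\<lambda>\<omega>. \<Sum>i<n. Y i \<omega> ^ r)"
    using assms by auto
  show "AE \<omega> in M. norm ((MAX i\<in>{..<n}. Y i \<omega>) ^ r) \<le> norm (\<Sum>i<n. Y i \<omega> ^ r)"
    using assms(3)
  proof eventually_elim
    case (elim \<omega>)
    have "(MAX i\<in>{..<n}. Y i \<omega>) \<in> (\<lambda>i. Y i \<omega>) ` {..<n}"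
      using assms(4) by (intro Max_in) (auto simp: lessThan_empty_iff)
    then obtain j where j: "j < n" "(MAX i\<in>{..<n}. Y i \<omega>) = Y j \<omega>"
      by auto
    have "Y j \<omega> ^ r \<le> (\<Sum>i<n. Y i \<omega> ^ r)"
      using j elim by (intro member_le_sum) auto
    then show ?case
      using elim by (simp add: j)
  qed
qed measurable

text \<open>The bound is the mean of a pointwise minorant of the maximum's power. The minorant is
  built from products of functions of separate copies, so independence evaluates its mean
  exactly.\<close>

lemma de_la_Cal_Carcamo_power:
  fixes Y :: "nat \<Rightarrow> 'a \<Rightarrow> real"
  assumes indep: "indep_vars (\<lambda>_. borel) Y UNIV"
    and D: "\<And>i. distr M borel (Y i) = D" "AE y in D. 0 \<le> y" "integrable D (\<lambda>y. y ^ r)"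
    and r: "1 \<le> r" and n: "1 \<le> n" and t: "0 \<le> t"
  shows "t - (t - (\<integral>y. y ^ r \<partial>D)) * cdf D (root r t) ^ (n - 1)
    \<le> expectation (\<lambda>\<omega>. (MAX i\<in>{..<n}. Y i \<omega>) ^ r)"
proof -
  \<comment> \<open>The copy of index \<open>m\<close> is the one held back; the threshold event
    involves only the indices below \<open>m\<close>.\<close>
  define m where "m = n - 1"
  have n_eq: "n = Suc m"
    using n by (simp add: m_def)
  define x where "x = root r t"
  have x: "0 \<le> x" "x ^ r = t"
    using r t by (auto simp: x_def)
  have rv [measurable]: "random_variable borel (Y i)" for i
    using indep by (auto simp: indep_vars_def)
  have nonneg: "AE \<omega> in M. \<forall>i. 0 \<le> Y i \<omega>"
    by (rule AE_all_nonneg_of_distr[OF rv D(1,2)])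
  have int: "integrable M (\<lambda>\<omega>. Y i \<omega> ^ r)" for i
    by (rule integrable_distrD[OF rv D(1) _ D(3)]) auto
  have setsD: "sets D = sets borel"
    using D(1)[of 0] by auto
  \<comment> \<open>The product of the \<open>g i\<close> is the indicator that the first
    \<open>m\<close> copies are at most \<open>x\<close>; the product of the \<open>f i\<close> is
    that indicator times the power of the last copy.\<close>
  define f where "f i = (if i < m then indicator {..x} else (\<lambda>y. y ^ r))" for i :: nat
  define g where "g i = (if i < m then indicator {..x} else (\<lambda>y. 1 :: real))" for i :: nat
  have [measurable]: "f i \<in> borel_measurable borel" "g i \<in> borel_measurable borel" for i
    by (auto simp: f_def g_def)
  have ind_int: "integrable M (\<lambda>\<omega>. indicator {..x} (Y i \<omega>) :: real)" for i
    by (rule integrable_const_bound[where B = 1]) (auto simp: indicator_def)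
  have ind_exp: "(\<integral>\<omega>. indicator {..x} (Y i \<omega>) \<partial>M) = cdf D x" for i
    by (subst integral_distr_eq[OF rv D(1)]) (auto simp: cdf_def setsD)
  have indep': "indep_vars (\<lambda>_. borel) (\<lambda>i \<omega>. h i (Y i \<omega>)) {..<n}"
    if "\<And>i. h i \<in> borel_measurable borel" for h :: "nat \<Rightarrow> real \<Rightarrow> real"
    using that by (intro indep_vars_compose2[OF indep_vars_subset[OF indep]]) auto
  have f_int: "integrable M (\<lambda>\<omega>. f i (Y i \<omega>))" for i
    by (simp add: f_def int ind_int)
  have g_int: "integrable M (\<lambda>\<omega>. g i (Y i \<omega>))" for i
    by (simp add: g_def ind_int)
  have F_int: "integrable M (\<lambda>\<omega>. \<Prod>i<n. f i (Y i \<omega>))"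
    by (rule indep_vars_integrable[OF _ indep' f_int]) auto
  have G_int: "integrable M (\<lambda>\<omega>. \<Prod>i<n. g i (Y i \<omega>))"
    by (rule indep_vars_integrable[OF _ indep' g_int]) auto
  have "(\<integral>\<omega>. (\<Prod>i<n. f i (Y i \<omega>)) \<partial>M) = (\<Prod>i<n. \<integral>\<omega>. f i (Y i \<omega>) \<partial>M)"
    by (rule indep_vars_lebesgue_integral[OF _ indep' f_int]) auto
  also have "\<dots> = cdf D x ^ m * (\<integral>y. y ^ r \<partial>D)"
    by (simp add: n_eq f_def ind_exp integral_distr_eq[OF rv D(1), of "\<lambda>y. y ^ r"])
  finally have F: "(\<integral>\<omega>. (\<Prod>i<n. f i (Y i \<omega>)) \<partial>M) = cdf D x ^ m * (\<integral>y. y ^ r \<partial>D)" .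
  have "(\<integral>\<omega>. (\<Prod>i<n. g i (Y i \<omega>)) \<partial>M) = (\<Prod>i<n. \<integral>\<omega>. g i (Y i \<omega>) \<partial>M)"
    by (rule indep_vars_lebesgue_integral[OF _ indep' g_int]) auto
  also have "\<dots> = cdf D x ^ m"
    by (simp add: n_eq g_def ind_exp prob_space)
  finally have G: "(\<integral>\<omega>. (\<Prod>i<n. g i (Y i \<omega>)) \<partial>M) = cdf D x ^ m" .
  have "t - (t - (\<integral>y. y ^ r \<partial>D)) * cdf D x ^ m =
      (\<integral>\<omega>. t * (1 - (\<Prod>i<n. g i (Y i \<omega>))) + (\<Prod>i<n. f i (Y i \<omega>)) \<partial>M)"
  proof -
    have "(\<integral>\<omega>. t * (1 - (\<Prod>i<n. g i (Y i \<omega>))) + (\<Prod>i<n. f i (Y i \<omega>)) \<partial>M) =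
        t * (1 - cdf D x ^ m) + cdf D x ^ m * (\<integral>y. y ^ r \<partial>D)"
      using F_int G_int by (simp add: F G prob_space)
    then show ?thesis
      by (simp add: algebra_simps)
  qed
  also have "\<dots> \<le> expectation (\<lambda>\<omega>. (MAX i\<in>{..<n}. Y i \<omega>) ^ r)"
  proof (rule integral_mono_AE)
    show "AE \<omega> in M. t * (1 - (\<Prod>i<n. g i (Y i \<omega>))) + (\<Prod>i<n. f i (Y i \<omega>))
        \<le> (MAX i\<in>{..<n}. Y i \<omega>) ^ r"
      using nonneg
    proof eventually_elim
      case (elim \<omega>)
      have Max: "Y i \<omega> \<le> (MAX i\<in>{..<n}. Y i \<omega>)" if "i < n" for i
        using that by (intro Max_ge) auto
      show ?case
      \<comment> \<open>On the threshold event the minorant collapses to the power of the last copy;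
        off it, both products vanish and only \<open>t\<close> remains.\<close>
      proof (cases "\<forall>i<m. Y i \<omega> \<le> x")
        case True
        then have "(\<Prod>i<n. g i (Y i \<omega>)) = 1" "(\<Prod>i<n. f i (Y i \<omega>)) = Y m \<omega> ^ r"
          by (simp_all add: n_eq g_def f_def)
        then show ?thesis
          using elim Max[of m] by (simp add: n_eq power_mono)
      next
        case False
        then obtain j where j: "j < m" "x < Y j \<omega>"
          by (auto simp: not_le)
        then have "j < n"
          by (simp add: n_eq)
        with j have prods: "(\<Prod>i<n. g i (Y i \<omega>)) = 0" "(\<Prod>i<n. f i (Y i \<omega>)) = 0"
          by (auto simp: g_def f_def intro!: prod_zero bexI[of _ j])
        have "x ^ r \<le> (MAX i\<in>{..<n}. Y i \<omega>) ^ r"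
          using j x Max[OF \<open>j < n\<close>] by (intro power_mono) linarith+
        then show ?thesis
          unfolding prods by (simp add: x)
      qed
    qed
  next
    show "integrable M (\<lambda>\<omega>. t * (1 - (\<Prod>i<n. g i (Y i \<omega>))) + (\<Prod>i<n. f i (Y i \<omega>)))"
      by (intro Bochner_Integration.integrable_add integrable_mult_right
          Bochner_Integration.integrable_diff integrable_const F_int G_int)
    show "integrable M (\<lambda>\<omega>. (MAX i\<in>{..<n}. Y i \<omega>) ^ r)"
      by (rule integrable_Max_power[OF rv int nonneg n])
  qed
  finally show ?thesis
    by (simp add: m_def x_def)
qed

text \<open>Above a level \<open>x\<close>, inserting the weight \<open>exp (s * (Y j - x))\<close>
  only increases the power of the largest copy \<open>Y j\<close>; summing this over all copies
  gives a union bound. Independence does not enter.\<close>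

lemma expectation_Max_power_le:
  fixes Y :: "nat \<Rightarrow> 'a \<Rightarrow> real"
  assumes rv [measurable]: "\<And>i. random_variable borel (Y i)"
    and D: "\<And>i. distr M borel (Y i) = D" "AE y in D. 0 \<le> y" "integrable D (\<lambda>y. y ^ r)"
    and s: "0 < s" "integrable D (\<lambda>y. y ^ r * exp (s * y))" and n: "1 \<le> n"
  shows "expectation (\<lambda>\<omega>. (MAX i\<in>{..<n}. Y i \<omega>) ^ r)
    \<le> (ln (real n) / s) ^ r + (\<integral>y. y ^ r * exp (s * y) \<partial>D)"
proof -
  \<comment> \<open>This level makes \<open>exp (- (s * x))\<close> equal to \<open>1 / n\<close>,
    which cancels the number of terms in the union bound.\<close>
  define x where "x = ln (real n) / s"
  have x: "0 \<le> x" "exp (- (s * x)) = 1 / real n"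
    using n s by (auto simp: x_def exp_minus field_simps)
  have nonneg: "AE \<omega> in M. \<forall>i. 0 \<le> Y i \<omega>"
    by (rule AE_all_nonneg_of_distr[OF rv D(1,2)])
  have int: "integrable M (\<lambda>\<omega>. Y i \<omega> ^ r)" for i
    by (rule integrable_distrD[OF rv D(1) _ D(3)]) auto
  have int_exp: "integrable M (\<lambda>\<omega>. Y i \<omega> ^ r * exp (s * Y i \<omega>))" for i
    by (rule integrable_distrD[OF rv D(1) _ s(2)]) auto
  have "expectation (\<lambda>\<omega>. (MAX i\<in>{..<n}. Y i \<omega>) ^ r)
      \<le> (\<integral>\<omega>. x ^ r + (\<Sum>i<n. Y i \<omega> ^ r * exp (s * Y i \<omega>) * exp (- (s * x))) \<partial>M)"
  proof (rule integral_mono_AE)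
    show "AE \<omega> in M. (MAX i\<in>{..<n}. Y i \<omega>) ^ r
        \<le> x ^ r + (\<Sum>i<n. Y i \<omega> ^ r * exp (s * Y i \<omega>) * exp (- (s * x)))"
      using nonneg
    proof eventually_elim
      case (elim \<omega>)
      have "(MAX i\<in>{..<n}. Y i \<omega>) \<in> (\<lambda>i. Y i \<omega>) ` {..<n}"
        using n by (intro Max_in) (auto simp: lessThan_empty_iff)
      then obtain j where j: "j < n" "(MAX i\<in>{..<n}. Y i \<omega>) = Y j \<omega>"
        by auto
      have le: "Y j \<omega> ^ r * exp (s * Y j \<omega>) * exp (- (s * x))
          \<le> (\<Sum>i<n. Y i \<omega> ^ r * exp (s * Y i \<omega>) * exp (- (s * x)))"
        using j elim by (intro member_le_sum) auto
      show ?case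
      proof (cases "Y j \<omega> \<le> x")
        case True
        then have "Y j \<omega> ^ r \<le> x ^ r"
          using elim by (intro power_mono) auto
        moreover have "0 \<le> (\<Sum>i<n. Y i \<omega> ^ r * exp (s * Y i \<omega>) * exp (- (s * x)))"
          using elim by (intro sum_nonneg) auto
        ultimately show ?thesis by (simp add: j)
      next
        case False
        \<comment> \<open>Beyond the level \<open>x\<close> the combined exponential weight is at
          least 1.\<close>
        then have "1 \<le> exp (s * Y j \<omega>) * exp (- (s * x))"
          using s by (simp flip: exp_add)
        then have "Y j \<omega> ^ r * 1 \<le> Y j \<omega> ^ r * (exp (s * Y j \<omega>) * exp (- (s * x)))"
          using elim by (intro mult_left_mono) auto
        moreover have "0 \<le> x ^ r"
          using x by simp
        ultimately show ?thesis
          using le by (simp add: j mult.assoc)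
      qed
    qed
  qed (use int_exp integrable_Max_power[OF rv int nonneg n] in auto)
  also have "\<dots> = x ^ r + (\<Sum>i<n. (\<integral>\<omega>. Y i \<omega> ^ r * exp (s * Y i \<omega>) \<partial>M) * exp (- (s * x)))"
    using int_exp by (simp add: prob_space)
  also have "\<dots> = x ^ r + (\<integral>y. y ^ r * exp (s * y) \<partial>D)"
    using n by (simp add: x integral_distr_eq[OF rv D(1), of "\<lambda>y. y ^ r * exp (s * y)"])
  finally show ?thesis
    by (simp add: x_def)
qed

end

section \<open>Growth of the lower bound and of the maximum's moments for Gamma variables\<close>

text \<open>The correction \<open>ln (ln n)\<close> is negligible against \<open>ln n\<close>, yet
  it raises the tail at the threshold to at least \<open>ln n / n\<close>. Hence the probability
  that \<open>n - 1\<close> copies all stay below the threshold tends to 0.\<close>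

lemma gamma_lower_bound_asymp:
  assumes "1 \<le> c" "1 \<le> r"
  defines "t \<equiv> \<lambda>n::nat. (ln (real n) - ln (ln (real n))) ^ r"
  shows "(\<lambda>n. gamma_lower_bound c r n (t n) / ln (real n) ^ r) \<longlonglongrightarrow> 1"
proof -
  define x where "x n = ln (real n) - ln (ln (real n))" for n :: nat
  define p where "p n = cdf (gamma_law c) (x n) ^ (n - 1)" for n
  interpret prob_space "gamma_law c"
    by (rule prob_space_gamma_law)
  have x_ev: "\<forall>\<^sub>F n in sequentially. 0 \<le> x n \<and> 1 < ln (real n)"
    unfolding x_def by (intro eventually_conj; real_asymp)
  have p_lim: "p \<longlonglongrightarrow> 0"
  proof (rule tendsto_sandwich[OF _ _ tendsto_const])
    show "\<forall>\<^sub>F n in sequentially. 0 \<le> p n"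
      by (simp add: p_def cdf_def)
    show "\<forall>\<^sub>F n in sequentially. p n \<le> exp (- (real n - 1) * (ln (real n) / real n))"
      using x_ev eventually_gt_at_top[of 1]
    proof eventually_elim
      case (elim n)
      have e: "exp (- x n) = ln (real n) / real n"
        using elim by (simp add: x_def exp_diff)
      have "cdf (gamma_law c) (x n) \<le> 1 - exp (- x n)"
        using elim assms by (intro cdf_gamma_law_le) auto
      also have "\<dots> \<le> exp (- (ln (real n) / real n))"
        using exp_ge_add_one_self[of "- exp (- x n)"] by (simp add: e)
      finally have "p n \<le> exp (- (ln (real n) / real n)) ^ (n - 1)"
        unfolding p_def by (intro power_mono) (auto simp: cdf_def)
      also have "\<dots> = exp (- (real n - 1) * (ln (real n) / real n))"
        \<comment> \<open>Here \<open>n > 1\<close> turns the truncated subtraction in the exponent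
          into a real one.\<close>
        using elim by (simp add: of_nat_diff left_diff_distrib diff_divide_distrib flip: exp_of_nat_mult)
      finally show ?case .
    qed
    show "(\<lambda>n. exp (- (real n - 1) * (ln (real n) / real n))) \<longlonglongrightarrow> 0"
      by real_asymp
  qed
  have x_lim: "(\<lambda>n. x n / ln (real n)) \<longlonglongrightarrow> 1"
    unfolding x_def by real_asymp
  have inv_lim: "(\<lambda>n. inverse (ln (real n))) \<longlonglongrightarrow> 0"
    by real_asymp
  \<comment> \<open>This is the lower bound divided by \<open>ln n ^ r\<close>, rewritten in terms
    of three sequences whose limits are known.\<close>
  have "(\<lambda>n. (x n / ln (real n)) ^ r -
      ((x n / ln (real n)) ^ r - gamma_moment c r * inverse (ln (real n)) ^ r) * p n)
      \<longlonglongrightarrow> 1 ^ r - (1 ^ r - gamma_moment c r * 0 ^ r) * 0"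
    by (intro tendsto_intros x_lim inv_lim p_lim)
  then have "(\<lambda>n. (x n / ln (real n)) ^ r -
      ((x n / ln (real n)) ^ r - gamma_moment c r * inverse (ln (real n)) ^ r) * p n) \<longlonglongrightarrow> 1"
    by simp
  then show ?thesis
  proof (rule Lim_transform_eventually)
    show "\<forall>\<^sub>F n in sequentially. (x n / ln (real n)) ^ r -
      ((x n / ln (real n)) ^ r - gamma_moment c r * inverse (ln (real n)) ^ r) * p n =
      gamma_lower_bound c r n (t n) / ln (real n) ^ r"
      using x_ev
    proof eventually_elim
      case (elim n)
      \<comment> \<open>The root undoes the power because \<open>x n\<close> is eventually
        nonnegative.\<close>
      have "root r (t n) = x n"
        using elim assms by (simp add: t_def x_def real_root_power_cancel)
      then show ?case
        using elim
        by (simp add: gamma_lower_bound_def p_def t_def x_def[symmetric] power_divide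
            power_inverse divide_inverse power_mult_distrib algebra_simps)
    qed
  qed
qed

text \<open>The lower half is inherited from any eventual minorant \<open>L\<close> of the right
  growth. For the upper half, the truncation estimate divided by \<open>ln n ^ r\<close> tends to
  \<open>(1 / s) ^ r\<close>, and \<open>s\<close> may be taken arbitrarily close to 1.\<close>

lemma (in prob_space) expectation_Max_gamma_power_asymp:
  fixes Y :: "nat \<Rightarrow> 'a \<Rightarrow> real"
  assumes "\<And>i. random_variable borel (Y i)" "\<And>i. distr M borel (Y i) = gamma_law c"
    and r: "1 \<le> r"
    and L: "\<forall>\<^sub>F n in sequentially. L n \<le> expectation (\<lambda>\<omega>. (MAX i\<in>{..<n}. Y i \<omega>) ^ r)"
      "(\<lambda>n. L n / ln (real n) ^ r) \<longlonglongrightarrow> 1"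
  shows "(\<lambda>n. expectation (\<lambda>\<omega>. (MAX i\<in>{..<n}. Y i \<omega>) ^ r) / ln (real n) ^ r) \<longlonglongrightarrow> 1"
proof (rule order_tendstoI)
  let ?e = "\<lambda>n. expectation (\<lambda>\<omega>. (MAX i\<in>{..<n}. Y i \<omega>) ^ r)"
  have ln_pos: "\<forall>\<^sub>F n in sequentially. 0 < ln (real n)"
    by real_asymp
  {
    fix a :: real assume "a < 1"
    show "\<forall>\<^sub>F n in sequentially. a < ?e n / ln (real n) ^ r"
      using order_tendstoD(1)[OF L(2) \<open>a < 1\<close>] L(1) ln_pos
    proof eventually_elim
      case (elim n)
      then have "L n / ln (real n) ^ r \<le> ?e n / ln (real n) ^ r"
        by (intro divide_right_mono) auto
      then show ?case
        using elim by linarith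
    qed
  next
    fix a :: real assume "1 < a"
    \<comment> \<open>Approaching 1 from below keeps the exponential moment finite while bringing
      \<open>(1 / s) ^ r\<close> under \<open>a\<close>.\<close>
    have "((\<lambda>s::real. (1 / s) ^ r) \<longlongrightarrow> (1 / 1) ^ r) (at_left 1)"
      by (intro tendsto_intros) auto
    then have "\<forall>\<^sub>F s in at_left (1::real). (1 / s) ^ r < a"
      using \<open>1 < a\<close> by (intro order_tendstoD(2)) auto
    moreover have "\<forall>\<^sub>F s in at_left (1::real). s \<in> {0<..<1}"
      by (rule eventually_at_leftI[of 0]) auto
    ultimately have "\<forall>\<^sub>F s in at_left (1::real). (1 / s) ^ r < a \<and> s \<in> {0<..<1}"
      by (rule eventually_conj)
    then obtain s :: real where s: "(1 / s) ^ r < a" "0 < s" "s < 1"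
      using eventually_happens[of _ "at_left (1::real)"] by auto
    define K where "K = (\<integral>y. y ^ r * exp (s * y) \<partial>gamma_law c)"
    have "(\<lambda>n. inverse (ln (real n))) \<longlonglongrightarrow> 0"
      by real_asymp
    then have "(\<lambda>n. (1 / s) ^ r + K * inverse (ln (real n)) ^ r) \<longlonglongrightarrow> (1 / s) ^ r + K * 0 ^ r"
      by (intro tendsto_add tendsto_mult tendsto_power tendsto_const)
    \<comment> \<open>The contribution of \<open>K\<close> disappears in the limit because
      \<open>0 ^ r = 0\<close> for \<open>r \<ge> 1\<close>.\<close>
    then have "\<forall>\<^sub>F n in sequentially. (1 / s) ^ r + K * inverse (ln (real n)) ^ r < a"
      by (rule order_tendstoD(2)) (use s r in \<open>auto simp: power_0_left\<close>)
    then show "\<forall>\<^sub>F n in sequentially. ?e n / ln (real n) ^ r < a"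
      using ln_pos eventually_ge_at_top[of 1]
    proof eventually_elim
      case (elim n)
      have "?e n \<le> (ln (real n) / s) ^ r + K"
        unfolding K_def using assms s elim
        by (intro expectation_Max_power_le AE_gamma_law_nonneg integrable_gamma_law_power
            integrable_gamma_law_power_exp) auto
      then have "?e n / ln (real n) ^ r \<le> ((ln (real n) / s) ^ r + K) / ln (real n) ^ r"
        using elim by (intro divide_right_mono) auto
      also have "\<dots> = (1 / s) ^ r + K * inverse (ln (real n)) ^ r"
        using elim s by (simp add: power_divide field_simps)
      finally show ?case
        using elim by linarith
    qed
  }
qed

theorem proposition24:
  fixes M :: "'a measure" and Y :: "nat \<Rightarrow> 'a \<Rightarrow> real" and c r :: nat
  assumes "prob_space M"
    and "c \<ge> 1" and "r \<ge> 1"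
    and "prob_space.indep_vars M (\<lambda>_. borel) Y UNIV"
    and "\<And>i. distr M borel (Y i) = gamma_law c"
  shows "(\<forall>n\<ge>1. \<forall>t\<ge>gamma_moment c r.
            gamma_lower_bound c r n t \<le> (\<integral>\<omega>. (MAX i\<in>{..<n}. Y i \<omega>) ^ r \<partial>M)) \<and>
         (\<exists>t :: nat \<Rightarrow> real.
            (\<forall>\<^sub>F n in sequentially. t n \<ge> gamma_moment c r) \<and>
            (\<lambda>n. gamma_lower_bound c r n (t n) / (\<integral>\<omega>. (MAX i\<in>{..<n}. Y i \<omega>) ^ r \<partial>M))
              \<longlonglongrightarrow> 1)"
proof -
  interpret prob_space M by fact
  let ?e = "\<lambda>n. expectation (\<lambda>\<omega>. (MAX i\<in>{..<n}. Y i \<omega>) ^ r)"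
  have rv: "random_variable borel (Y i)" for i
    using assms(4) by (auto simp: indep_vars_def)
  have bound: "gamma_lower_bound c r n t \<le> ?e n" if "1 \<le> n" "gamma_moment c r \<le> t" for n t
    unfolding gamma_lower_bound_def gamma_moment_def
    using assms that gamma_moment_nonneg[of c r]
    by (intro de_la_Cal_Carcamo_power AE_gamma_law_nonneg integrable_gamma_law_power) auto
  \<comment> \<open>The threshold solves \<open>n * exp (- x) = ln n\<close> for
    \<open>x = root r (t n)\<close>: the expected number of exceedances diverges, while
    \<open>x\<close> stays asymptotic to \<open>ln n\<close>.\<close>
  define t where "t n = (ln (real n) - ln (ln (real n))) ^ r" for n :: nat
  have "filterlim (\<lambda>n::nat. ln (real n) - ln (ln (real n))) at_top sequentially"
    by real_asymp
  then have "filterlim t at_top sequentially"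
    unfolding t_def using assms(3) by (intro filterlim_pow_at_top) auto
  then have t_ev: "\<forall>\<^sub>F n in sequentially. gamma_moment c r \<le> t n"
    by (simp add: filterlim_at_top)
  have lower: "(\<lambda>n. gamma_lower_bound c r n (t n) / ln (real n) ^ r) \<longlonglongrightarrow> 1"
    unfolding t_def using assms(2,3) by (rule gamma_lower_bound_asymp)
  have "\<forall>\<^sub>F n in sequentially. gamma_lower_bound c r n (t n) \<le> ?e n"
    using t_ev eventually_ge_at_top[of 1] by eventually_elim (rule bound)
  \<comment> \<open>The lower bound itself serves as the minorant \<open>L\<close>, so both
    sequences are asymptotic to \<open>ln n ^ r\<close> and their quotient tends to 1.\<close>
  from expectation_Max_gamma_power_asymp[OF rv assms(5,3) this lower]
  have "(\<lambda>n. ?e n / ln (real n) ^ r) \<longlonglongrightarrow> 1" .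
  from tendsto_divide[OF lower this]
  have "(\<lambda>n. gamma_lower_bound c r n (t n) / ln (real n) ^ r / (?e n / ln (real n) ^ r)) \<longlonglongrightarrow> 1"
    by simp
  moreover have "\<forall>\<^sub>F n in sequentially. 0 < ln (real n)"
    by real_asymp
  ultimately have "(\<lambda>n. gamma_lower_bound c r n (t n) / ?e n) \<longlonglongrightarrow> 1"
    by (elim Lim_transform_eventually, elim eventually_mono) auto
  with bound t_ev show ?thesis
    by blast
qed

end
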